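(* For every integer $r\ge 1$ and every even integer $s\ge 2$, $\chi_{la}(DF_r(2s))=3$, where $DF_r(2s)=rDF(2s)+FB(s)$.
   Context: For a graph $G=(V,E)$ with $|E|=m$ and no isolated vertices, a local antimagic labeling is a bijection $f:E\to\{1,\dots,m\}$ such that $f^+(u)\ne f^+(v)$ for every edge $uv$, where $f^+(x)=\sum f(e)$ over all edges $e$ incident to $x$. The local antimagic chromatic number $\chi_{la}(G)$ is the minimum, over all local antimagic labelings $f$ of $G$, of the number of distinct values taken by $f^+$ (also for disconnected graphs). $G+H$ is the disjoint union and $rG$ the disjoint union of $r$ copies of $G$. The fan graph with $n$ blades is $FB(n)=nP_3\vee K_1$. For $s\ge 1$, let $S_1,S_2$ be two disjoint copies of $sP_3$. The diamond fan $DF(2s)$ is obtained from $S_1+S_2$ by adding a vertex $y$ adjacent to every degree-1 vertex of $S_1$ and every degree-2 vertex of $S_2$, and a vertex $z$ adjacent to every degree-1 vertex of $S_2$ and every degree-2 vertex of $S_1$. *)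

theory Defs
  imports Main
begin

text \<open>
  A simple graph is given by its vertex set and its edge set, an edge being the two-element
  set of its endpoints. All the graphs constructed below are finite and simple.
\<close>

datatype 'a graph = Graph (verts: "'a set") (edges: "'a set set")

definition incident :: "'a graph \<Rightarrow> 'a \<Rightarrow> 'a set set" where
  "incident G x = {e \<in> edges G. x \<in> e}"

definition degree :: "'a graph \<Rightarrow> 'a \<Rightarrow> nat" where
  "degree G x = card (incident G x)"

definition verts_of_degree :: "'a graph \<Rightarrow> nat \<Rightarrow> 'a set" where
  "verts_of_degree G d = {x \<in> verts G. degree G x = d}"

definition induced :: "'a graph \<Rightarrow> ('a set \<Rightarrow> nat) \<Rightarrow> 'a \<Rightarrow> nat" where
  "induced G f x = (\<Sum>e\<in>incident G x. f e)"

definition local_antimagic :: "'a graph \<Rightarrow> ('a set \<Rightarrow> nat) \<Rightarrow> bool" where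
  "local_antimagic G f \<longleftrightarrow>
     bij_betw f (edges G) {1..card (edges G)} \<and>
     (\<forall>u v. {u, v} \<in> edges G \<longrightarrow> induced G f u \<noteq> induced G f v)"

text \<open>
  Meant for finite graphs without isolated vertices. On \<^typ>\<open>nat\<close>, \<^term>\<open>Inf\<close> is the minimum of a
  nonempty set and \<open>0\<close> for the empty set, so a positive value entails that a local antimagic
  labeling exists.
\<close>

definition chi_la :: "'a graph \<Rightarrow> nat" where
  "chi_la G = Inf {card (induced G f ` verts G) | f. local_antimagic G f}"

definition path_graph :: "nat \<Rightarrow> nat graph" where
  "path_graph n = Graph {..<n} {{i, Suc i} | i. Suc i < n}"

definition complete_graph :: "nat \<Rightarrow> nat graph" where
  "complete_graph n = Graph {..<n} {{i, j} | i j. i < n \<and> j < n \<and> i \<noteq> j}"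

definition disjoint_union :: "'a graph \<Rightarrow> 'b graph \<Rightarrow> ('a + 'b) graph" where
  "disjoint_union G H =
     Graph (verts G <+> verts H) ((`) Inl ` edges G \<union> (`) Inr ` edges H)"

definition copies :: "nat \<Rightarrow> 'a graph \<Rightarrow> (nat \<times> 'a) graph" where
  "copies r G = Graph ({..<r} \<times> verts G) (\<Union>i<r. (`) (Pair i) ` edges G)"

definition graph_join :: "'a graph \<Rightarrow> 'b graph \<Rightarrow> ('a + 'b) graph" where
  "graph_join G H =
     Graph (verts G <+> verts H)
       (edges (disjoint_union G H) \<union> {{Inl u, Inr v} | u v. u \<in> verts G \<and> v \<in> verts H})"

text \<open>The new vertex is \<^term>\<open>None\<close>, and \<open>A\<close> is its set of neighbours.\<close>

definition add_vertex :: "'a graph \<Rightarrow> 'a set \<Rightarrow> 'a option graph" where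
  "add_vertex G A =
     Graph (insert None (Some ` verts G)) ((`) Some ` edges G \<union> {{None, Some a} | a. a \<in> A})"

definition fan_blades :: "nat \<Rightarrow> ((nat \<times> nat) + nat) graph" where
  "fan_blades n = graph_join (copies n (path_graph 3)) (complete_graph 1)"

text \<open>
  \<open>diamond_fan s\<close> is \<open>DF(2s)\<close>. The summands \<^term>\<open>Inl\<close> and \<^term>\<open>Inr\<close> carry \<open>S\<^sub>1\<close> and \<open>S\<^sub>2\<close>; the
  vertex \<open>y\<close> is added first and \<open>z\<close> second, so that \<open>z = None\<close> and \<open>y = Some None\<close>. The degrees
  are those in \<open>S\<^sub>1\<close> and \<open>S\<^sub>2\<close>, before \<open>y\<close> and \<open>z\<close> are added.
\<close>

definition diamond_fan :: "nat \<Rightarrow> ((nat \<times> nat) + (nat \<times> nat)) option option graph" where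
  "diamond_fan s =
     (let S = copies s (path_graph 3);
          Ends = verts_of_degree S 1;
          Mids = verts_of_degree S 2;
          Y = Inl ` Ends \<union> Inr ` Mids;
          Z = Inr ` Ends \<union> Inl ` Mids
      in add_vertex (add_vertex (disjoint_union S S) Y) (Some ` Z))"

text \<open>\<open>diamond_fan_r r s\<close> is \<open>DF\<^sub>r(2s) = r DF(2s) + FB(s)\<close>.\<close>

definition diamond_fan_r ::
    "nat \<Rightarrow> nat \<Rightarrow> ((nat \<times> ((nat \<times> nat) + (nat \<times> nat)) option option) + ((nat \<times> nat) + nat)) graph" where
  "diamond_fan_r r s = disjoint_union (copies r (diamond_fan s)) (fan_blades s)"

end

theory Submission
  imports Defs
begin

text \<open>
  The graph \<open>DF\<^sub>r(2s)\<close> consists of \<open>2r + 1\<close> groups of \<open>s\<close> blades \<open>P\<^sub>3\<close>, with one apex per group: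
  the ends of the blades in group \<open>g\<close> are joined to apex
  \<open>g\<close>, the middles to apex \<open>\<sigma> g\<close>, where \<open>\<sigma>\<close> swaps the two halves of each diamond fan and fixes the
  group of the fan. Let \<open>N = (2r + 1) s\<close>, and give the middle-apex edges the labels \<open>m = 1, \<dots>, N\<close>.
  In the blade with label \<open>m\<close>, label the two path edges \<open>4N + 1 - 2m\<close> and \<open>4N + m\<close>, and
  the corresponding end-apex edges \<open>2N + 2m\<close> and \<open>2N + 1 - m\<close>. Then all ends have sum \<open>6N + 1\<close> and all
  middles have sum \<open>8N + 1\<close>. The end-apex edges of a blade sum to \<open>4N + 1 + m\<close>, so all apices have the
  same sum once the \<open>m\<close> have the same total in every group; as \<open>s\<close> is even, this is
  achieved by dealing out \<open>1, \<dots>, N\<close> to the groups in alternating directions. A triangle in the fan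
  forces three values.
\<close>

section \<open>Dealing out labels to groups with equal totals\<close>

text \<open>Round \<open>t\<close> deals the numbers \<open>t * c + 1, ..., t * c + c\<close>,
  upwards in \<open>g\<close> when \<open>t\<close> is even and downwards when it is odd.\<close>

definition boustrophedon :: "nat \<Rightarrow> nat \<Rightarrow> nat \<Rightarrow> nat" where
  "boustrophedon c g t = t * c + (if even t then g + 1 else c - g)"

lemma boustrophedon_bounds:
  assumes "g < c"
  shows "t * c < boustrophedon c g t" "boustrophedon c g t \<le> Suc t * c"
  using assms by (auto simp: boustrophedon_def)

lemma boustrophedon_le:
  assumes "g < c" "t < s"
  shows "boustrophedon c g t \<le> c * s"
proof -
  have "boustrophedon c g t \<le> Suc t * c" by (rule boustrophedon_bounds(2)[OF assms(1)])
  also have "\<dots> \<le> s * c" using assms(2) by (intro mult_le_mono1) simp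
  finally show ?thesis by (simp add: mult.commute)
qed

text \<open>Different rounds fill disjoint intervals \<open>(t * c, (t + 1) * c]\<close>, and within
  a round the value determines the group.\<close>

lemma boustrophedon_inj:
  assumes "g < c" "g' < c" "boustrophedon c g t = boustrophedon c g' t'"
  shows "g = g' \<and> t = t'"
proof -
  have mono: "Suc a * c \<le> b * c" if "a < b" for a b
    using that by (intro mult_le_mono1) simp
  have "t = t'"
  proof (rule ccontr)
    assume "t \<noteq> t'"
    then consider "t < t'" | "t' < t" by linarith
    then show False
      using mono[of t t'] mono[of t' t] boustrophedon_bounds[OF assms(1), of t]
        boustrophedon_bounds[OF assms(2), of t'] assms(3)
      by cases linarith+
  qed
  then show ?thesis
    using assms by (auto simp: boustrophedon_def split: if_splits)
qed

text \<open>In rounds \<open>2 * k\<close> and \<open>2 * k + 1\<close> the offsets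
  \<open>g + 1\<close> and \<open>c - g\<close> add up to \<open>c + 1\<close>, so \<open>g\<close>
  cancels.\<close>

lemma sum_boustrophedon:
  assumes "g < c"
  shows "(\<Sum>t<2 * k. boustrophedon c g t) = k * (2 * k * c + 1)"
proof (induction k)
  case (Suc k)
  have "boustrophedon c g (2 * k) + boustrophedon c g (Suc (2 * k)) = 4 * k * c + 2 * c + 1"
    using assms by (simp add: boustrophedon_def algebra_simps)
  then show ?case using Suc by (simp add: algebra_simps)
qed simp

section \<open>The five labels of one blade\<close>

definition blade_label :: "nat \<Rightarrow> nat \<Rightarrow> nat \<Rightarrow> nat" where
  "blade_label N m k =
     (if k = 0 then 4 * N + 1 - 2 * m else if k = 1 then 4 * N + m
      else if k = 2 then 2 * N + 2 * m else if k = 3 then 2 * N + 1 - m else m)"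

lemma less_5_iff: "k < (5::nat) \<longleftrightarrow> k = 0 \<or> k = 1 \<or> k = 2 \<or> k = 3 \<or> k = 4"
  by auto

lemma blade_label_range:
  assumes "1 \<le> m" "m \<le> N"
  shows "blade_label N m k \<in> {1..5 * N}"
  using assms by (auto simp: blade_label_def)

text \<open>As \<open>m\<close> runs from 1 to \<open>N\<close>, the kinds \<open>k\<close> = 4, 3,
  1 fill \<open>1..N\<close>, \<open>N+1..2N\<close> and \<open>4N+1..5N\<close>, while
  \<open>k\<close> = 0 and \<open>k\<close> = 2 take the odd and the even numbers of
  \<open>2N+1..4N\<close>.\<close>

lemma blade_label_inj:
  assumes "1 \<le> m" "m \<le> N" "1 \<le> m'" "m' \<le> N" "k < 5" "k' < 5"
    and eq: "blade_label N m k = blade_label N m' k'"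
  shows "m = m' \<and> k = k'"
proof -
  have parity: "4 * N + 1 - 2 * a \<noteq> 2 * N + 2 * b" if "a \<le> N" for a b
  proof -
    have "4 * N + 1 - 2 * a = 2 * (2 * N - a) + 1" using that by simp
    then show ?thesis by presburger
  qed
  note parity = parity[OF assms(2), of m'] parity[OF assms(4), of m]
  show ?thesis
    using \<open>k < 5\<close> \<open>k' < 5\<close> unfolding less_5_iff
    by (elim disjE; insert assms(1-4) eq parity; simp add: blade_label_def)
qed

section \<open>Abstract blade groups: labeling and vertex sums\<close>

text \<open>\<open>V g t j\<close> is position \<open>j\<close> on blade \<open>t\<close> of group
  \<open>g\<close>, with middle \<open>j = 1\<close>. Abstract names for the vertices let the halves
  of the diamond fans and the fan be treated alike, away from their sum and option types.\<close>

locale blade_groups =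
  fixes V :: "nat \<Rightarrow> nat \<Rightarrow> nat \<Rightarrow> 'a" and X :: "nat \<Rightarrow> 'a" and \<sigma> :: "nat \<Rightarrow> nat"
    and c s :: nat
  assumes V_inj [simp]: "V g t j = V g' t' j' \<longleftrightarrow> g = g' \<and> t = t' \<and> j = j'"
    and X_inj [simp]: "X g = X g' \<longleftrightarrow> g = g'"
    and V_neq_X [simp]: "V g t j \<noteq> X g'"
    and \<sigma>_bij: "bij_betw \<sigma> {..<c} {..<c}"
    and s_ge: "2 \<le> s" and s_even: "even s" and c_pos: "0 < c"
begin

lemma X_neq_V [simp]: "X g' \<noteq> V g t j"
  using V_neq_X by metis

text \<open>The index \<open>k\<close> agrees with that of \<open>blade_label\<close>: path edges 0
  and 1, end-apex edges 2 and 3, middle-apex edge 4.\<close>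

definition edge :: "nat \<times> nat \<times> nat \<Rightarrow> 'a set" where
  "edge = (\<lambda>(g, t, k).
     if k = 0 then {V g t 0, V g t 1} else if k = 1 then {V g t 1, V g t 2}
     else if k = 2 then {V g t 0, X g} else if k = 3 then {V g t 2, X g}
     else {V g t 1, X (\<sigma> g)})"

definition idx :: "(nat \<times> nat \<times> nat) set" where
  "idx = {..<c} \<times> {..<s} \<times> {..<5}"

definition G :: "'a graph" where
  "G = Graph ((\<lambda>(g, t, j). V g t j) ` ({..<c} \<times> {..<s} \<times> {..<3}) \<union> X ` {..<c}) (edge ` idx)"

abbreviation N :: nat where "N \<equiv> c * s"

definition idx_label :: "nat \<times> nat \<times> nat \<Rightarrow> nat" where
  "idx_label = (\<lambda>(g, t, k). blade_label N (boustrophedon c g t) k)"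

definition labeling :: "'a set \<Rightarrow> nat" where
  "labeling e = idx_label (the_inv_into idx edge e)"

lemma edges_G [simp]: "edges G = edge ` idx"
  by (simp add: G_def)

lemma verts_G: "verts G = (\<lambda>(g, t, j). V g t j) ` ({..<c} \<times> {..<s} \<times> {..<3}) \<union> X ` {..<c}"
  by (simp add: G_def)

text \<open>Path edges avoid the apices; any other edge has exactly one vertex of the form
  \<open>V g t j\<close>, which determines its index.\<close>

lemma inj_edge: "inj_on edge idx"
proof (rule inj_onI)
  fix a b
  assume mem: "a \<in> idx" "b \<in> idx" and eq: "edge a = edge b"
  obtain g t k where a: "a = (g, t, k)" by (cases a)
  obtain g' t' k' where b: "b = (g', t', k')" by (cases b)
  have "k < 5" "k' < 5" using mem by (auto simp: a b idx_def)
  then show "a = b"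
    using eq unfolding a b less_5_iff
    by (elim disjE; simp add: edge_def doubleton_eq_iff)
qed

lemma card_idx: "card idx = 5 * N"
  by (simp add: idx_def)

lemma boustrophedon_range:
  assumes "g < c" "t < s"
  shows "1 \<le> boustrophedon c g t" "boustrophedon c g t \<le> N"
  using boustrophedon_bounds(1)[OF assms(1), of t] boustrophedon_le[OF assms] by linarith+

lemma bij_idx_label: "bij_betw idx_label idx {1..5 * N}"
proof -
  have inj: "inj_on idx_label idx"
  proof (rule inj_onI)
    fix x y
    assume mem': "x \<in> idx" "y \<in> idx" and eq': "idx_label x = idx_label y"
    obtain g t k where x: "x = (g, t, k)" by (cases x)
    obtain g' t' k' where y: "y = (g', t', k')" by (cases y)
    note mem = mem'[unfolded x y] and eq = eq'[unfolded x y]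
    have "boustrophedon c g t = boustrophedon c g' t' \<and> k = k'"
      by (rule blade_label_inj[of _ N])
        (use mem eq boustrophedon_range in \<open>auto simp: idx_def idx_label_def\<close>)
    then show "x = y"
      using boustrophedon_inj[of g c g' t t'] mem by (auto simp: x y idx_def)
  qed
  have "idx_label ` idx \<subseteq> {1..5 * N}"
  proof (rule image_subsetI)
    fix x assume "x \<in> idx"
    then show "idx_label x \<in> {1..5 * N}"
      using blade_label_range[OF boustrophedon_range] by (cases x) (simp add: idx_def idx_label_def)
  qed
  \<comment> \<open>Surjectivity comes from counting: an injective image of \<open>5 * N\<close>
    indices inside \<open>{1..5 * N}\<close> is everything.\<close>
  moreover have "card (idx_label ` idx) = card {1..5 * N}"
    using card_image[OF inj] card_idx by simp
  ultimately have "idx_label ` idx = {1..5 * N}"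
    by (intro card_subset_eq) auto
  with inj show ?thesis by (simp add: bij_betw_def)
qed

lemma labeling_edge: "i \<in> idx \<Longrightarrow> labeling (edge i) = idx_label i"
  by (simp add: labeling_def the_inv_into_f_f[OF inj_edge])

lemma bij_labeling: "bij_betw labeling (edges G) {1..card (edges G)}"
proof -
  have "bij_betw (the_inv_into idx edge) (edge ` idx) idx"
    by (rule bij_betw_the_inv_into) (simp add: bij_betw_def inj_edge)
  then have "bij_betw (idx_label \<circ> the_inv_into idx edge) (edge ` idx) {1..5 * N}"
    using bij_idx_label by (rule bij_betw_trans)
  moreover have "idx_label \<circ> the_inv_into idx edge = labeling"
    by (simp add: fun_eq_iff labeling_def)
  ultimately show ?thesis
    using card_image[OF inj_edge] card_idx by simp
qed

lemma induced_eq: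
  assumes "J \<subseteq> idx" "\<And>i. i \<in> idx \<Longrightarrow> x \<in> edge i \<longleftrightarrow> i \<in> J"
  shows "induced G labeling x = (\<Sum>i\<in>J. idx_label i)"
proof -
  have "incident G x = edge ` J"
    using assms by (auto simp: incident_def)
  moreover have "inj_on edge J"
    using inj_edge assms(1) by (rule inj_on_subset)
  ultimately show ?thesis
    using assms(1) by (auto simp: induced_def sum.reindex labeling_edge intro!: sum.cong)
qed

lemma mem_edge_iff:
  assumes "(g, t, k) \<in> idx"
  shows "V h u j \<in> edge (g, t, k) \<longleftrightarrow> h = g \<and> u = t \<and>
           (j = 0 \<and> k \<in> {0, 2} \<or> j = 1 \<and> k \<in> {0, 1, 4} \<or> j = 2 \<and> k \<in> {1, 3})"
    and "X h \<in> edge (g, t, k) \<longleftrightarrow> g = h \<and> k \<in> {2, 3} \<or> \<sigma> g = h \<and> k = 4"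
proof -
  have "k < 5" using assms by (simp add: idx_def)
  then show "V h u j \<in> edge (g, t, k) \<longleftrightarrow> h = g \<and> u = t \<and>
           (j = 0 \<and> k \<in> {0, 2} \<or> j = 1 \<and> k \<in> {0, 1, 4} \<or> j = 2 \<and> k \<in> {1, 3})"
    unfolding less_5_iff by (elim disjE; force simp: edge_def)
  show "X h \<in> edge (g, t, k) \<longleftrightarrow> g = h \<and> k \<in> {2, 3} \<or> \<sigma> g = h \<and> k = 4"
    using \<open>k < 5\<close> unfolding less_5_iff by (elim disjE; force simp: edge_def)
qed

text \<open>The blade parameter \<open>m\<close> cancels at each vertex: the edges meeting there are
  0 and 2 at one end, 1 and 3 at the other, and 0, 1 and 4 at the middle.\<close>

lemma induced_V:
  assumes "g < c" "t < s" "j < 3"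
  shows "induced G labeling (V g t j) = (if j = 1 then 8 * N + 1 else 6 * N + 1)"
proof -
  define K :: "nat set" where "K = (if j = 0 then {0, 2} else if j = 1 then {0, 1, 4} else {1, 3})"
  have j: "j = 0 \<or> j = 1 \<or> j = 2" using assms(3) by auto
  have "induced G labeling (V g t j) = (\<Sum>i\<in>{g} \<times> {t} \<times> K. idx_label i)"
  proof (rule induced_eq)
    show "{g} \<times> {t} \<times> K \<subseteq> idx"
      using assms by (auto simp: idx_def K_def split: if_splits)
    fix i assume "i \<in> idx"
    then show "V g t j \<in> edge i \<longleftrightarrow> i \<in> {g} \<times> {t} \<times> K"
      using j by (cases i) (auto simp: mem_edge_iff K_def)
  qed
  also have "\<dots> = (\<Sum>k\<in>K. blade_label N (boustrophedon c g t) k)"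
    by (simp add: sum.cartesian_product[symmetric] idx_label_def)
  also have "\<dots> = (if j = 1 then 8 * N + 1 else 6 * N + 1)"
    using j boustrophedon_range[OF assms(1,2)] by (auto simp: K_def blade_label_def)
  finally show ?thesis .
qed

lemma induced_X:
  assumes "h < c"
  shows "induced G labeling (X h) = s * (5 * N + 2)"
proof -
  \<comment> \<open>Apex \<open>h\<close> meets the ends of its own group and the middles of exactly
    one group \<open>g\<close>, the preimage of \<open>h\<close> under
    \<open>\<sigma>\<close>.\<close>
  obtain g where g: "g < c" "\<sigma> g = h"
    using \<sigma>_bij assms by (metis bij_betw_def imageE lessThan_iff)
  have \<sigma>_eq: "\<sigma> g' = h \<longleftrightarrow> g' = g" if "g' < c" for g'
    using \<sigma>_bij that g by (metis bij_betw_def inj_onD lessThan_iff)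
  \<comment> \<open>Evenness of \<open>s\<close> pairs the rounds, which makes the total the same
    for every group.\<close>
  obtain k where k: "s = 2 * k" using s_even by (elim evenE)
  have total: "(\<Sum>t<s. boustrophedon c a t) = k * (N + 1)" if "a < c" for a
    using sum_boustrophedon[OF that, of k] by (simp add: k algebra_simps)
  let ?J = "{h} \<times> {..<s} \<times> {2, 3}" and ?K = "{g} \<times> {..<s} \<times> {4}"
  have "induced G labeling (X h) = (\<Sum>i\<in>?J \<union> ?K. idx_label i)"
  proof (rule induced_eq)
    show "?J \<union> ?K \<subseteq> idx"
      using assms g by (auto simp: idx_def)
    fix i assume "i \<in> idx"
    then show "X h \<in> edge i \<longleftrightarrow> i \<in> ?J \<union> ?K"
      by (cases i) (auto simp: mem_edge_iff idx_def \<sigma>_eq)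
  qed
  also have "\<dots> = (\<Sum>i\<in>?J. idx_label i) + (\<Sum>i\<in>?K. idx_label i)"
    by (rule sum.union_disjoint) auto
  also have "(\<Sum>i\<in>?J. idx_label i) = (\<Sum>t<s. 4 * N + 1 + boustrophedon c h t)"
  proof -
    have "(\<Sum>i\<in>?J. idx_label i) = (\<Sum>t<s. \<Sum>k\<in>{2, 3}. blade_label N (boustrophedon c h t) k)"
      by (simp add: sum.cartesian_product[symmetric] idx_label_def)
    also have "\<dots> = (\<Sum>t<s. 4 * N + 1 + boustrophedon c h t)"
    proof (rule sum.cong[OF refl])
      fix t assume "t \<in> {..<s}"
      then have "boustrophedon c h t \<le> N"
        using boustrophedon_range(2)[OF assms, of t] by simp
      then show "(\<Sum>k\<in>{2, 3}. blade_label N (boustrophedon c h t) k) =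
          4 * N + 1 + boustrophedon c h t"
        by (simp add: blade_label_def)
    qed
    finally show ?thesis .
  qed
  also have "(\<Sum>i\<in>?K. idx_label i) = (\<Sum>t<s. boustrophedon c g t)"
    by (simp add: sum.cartesian_product[symmetric] idx_label_def blade_label_def)
  also have "(\<Sum>t<s. 4 * N + 1 + boustrophedon c h t) + (\<Sum>t<s. boustrophedon c g t) =
      s * (5 * N + 2)"
    by (simp only: sum.distrib total[OF assms] total[OF g(1)]) (simp add: k algebra_simps)
  finally show ?thesis .
qed

text \<open>Puts the apex sum above both sums occurring on blades, which separates the ends of every
  apex edge.\<close>

lemma apex_sum_gt: "8 * N + 1 < s * (5 * N + 2)"
proof -
  have "8 * N + 1 < 2 * (5 * N + 2)" by simp
  also have "\<dots> \<le> s * (5 * N + 2)"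
    using s_ge by (rule mult_le_mono1)
  finally show ?thesis .
qed

lemma N_pos: "0 < N"
  using s_ge c_pos by simp

lemma local_antimagic_labeling: "local_antimagic G labeling"
  unfolding local_antimagic_def
proof (intro conjI allI impI)
  fix u v assume "{u, v} \<in> edges G"
  then obtain g t k where i: "g < c" "t < s" "k < 5" and e: "{u, v} = edge (g, t, k)"
    by (auto simp: idx_def)
  have "\<sigma> g < c" using \<sigma>_bij i(1) by (auto simp: bij_betw_def)
  note vals = induced_V[OF i(1,2)] induced_X[OF i(1)] induced_X[OF this]
  show "induced G labeling u \<noteq> induced G labeling v"
    using i(3) unfolding less_5_iff
    by (elim disjE; insert e vals apex_sum_gt N_pos; auto simp: edge_def doubleton_eq_iff)
qed (rule bij_labeling)

lemma card_induced_le: "card (induced G labeling ` verts G) \<le> 3"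
proof -
  have "induced G labeling ` verts G \<subseteq> {6 * N + 1, 8 * N + 1, s * (5 * N + 2)}"
    by (auto simp: verts_G induced_V induced_X)
  then have "card (induced G labeling ` verts G) \<le> card {6 * N + 1, 8 * N + 1, s * (5 * N + 2)}"
    by (rule card_mono[rotated]) simp
  also have "\<dots> \<le> 3" by (simp add: card_insert_if)
  finally show ?thesis .
qed

end

section \<open>Upper and lower bounds for \<open>chi_la\<close>\<close>

lemma chi_la_le:
  assumes "local_antimagic G f"
  shows "chi_la G \<le> card (induced G f ` verts G)"
  unfolding chi_la_def by (rule cInf_lower) (use assms in auto)

text \<open>Any labeling gives three pairwise adjacent vertices distinct sums. The labeling
  \<open>f\<close> makes the set under \<open>Inf\<close> nonempty; otherwise \<open>chi_la\<close>
  would be 0.\<close>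

lemma chi_la_ge_3_if_triangle:
  assumes "finite (verts G)" "local_antimagic G f"
    and "{a, b, d} \<subseteq> verts G" "{a, b} \<in> edges G" "{b, d} \<in> edges G" "{a, d} \<in> edges G"
  shows "3 \<le> chi_la G"
  unfolding chi_la_def
proof (rule cInf_greatest)
  fix n assume "n \<in> {card (induced G f ` verts G) |f. local_antimagic G f}"
  then obtain f where f: "local_antimagic G f" and n: "n = card (induced G f ` verts G)"
    by auto
  have "3 = card {induced G f a, induced G f b, induced G f d}"
    using f assms(4-) by (auto simp: local_antimagic_def)
  also have "\<dots> \<le> n"
    unfolding n using assms(1,3) by (intro card_mono) auto
  finally show "3 \<le> n" .
qed (use assms(2) in auto)

section \<open>Edges and degrees in copies of \<open>P_3\<close>\<close>

lemma edges_path_3: "edges (path_graph 3) = {{0, 1}, {1, 2}}"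
proof -
  have "Suc i < 3 \<longleftrightarrow> i = 0 \<or> i = 1" for i by auto
  then show ?thesis by (auto simp: path_graph_def numeral_2_eq_2)
qed

lemma edges_copies_path_3:
  "edges (copies s (path_graph 3)) = (\<Union>t<s. {{(t, 0), (t, 1)}, {(t, 1), (t, 2)}})"
  by (simp add: copies_def edges_path_3)

lemma verts_copies_path_3: "verts (copies s (path_graph 3)) = {..<s} \<times> {..<3}"
  by (simp add: copies_def path_graph_def)

lemma degree_copies_path_3:
  assumes "t < s" "j < 3"
  shows "degree (copies s (path_graph 3)) (t, j) = (if j = 1 then 2 else 1)"
proof -
  \<comment> \<open>Edges are sorted by copy, since only copy \<open>t\<close> has edges at
    \<open>(t, j)\<close>.\<close>
  define B :: "nat \<Rightarrow> (nat \<times> nat) set set" where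
    "B u = {{(u, 0), (u, 1)}, {(u, 1), (u, 2)}}" for u
  have B: "u = t" if "e \<in> B u" "(t, j) \<in> e" for u e
    using that by (auto simp: B_def)
  have "incident (copies s (path_graph 3)) (t, j) = {e \<in> (\<Union>u<s. B u). (t, j) \<in> e}"
    by (simp only: incident_def edges_copies_path_3 B_def)
  also have "\<dots> = {e \<in> B t. (t, j) \<in> e}"
    using B assms(1) by blast
  finally have inc: "incident (copies s (path_graph 3)) (t, j) = {e \<in> B t. (t, j) \<in> e}" .
  have "j = 0 \<or> j = 1 \<or> j = 2" using assms(2) by auto
  then have "{e \<in> B t. (t, j) \<in> e} =
      (if j = 0 then {{(t, 0), (t, 1)}} else if j = 1 then B t else {{(t, 1), (t, 2)}})"
    by (elim disjE; force simp: B_def)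
  then show ?thesis by (simp add: degree_def inc B_def doubleton_eq_iff)
qed

lemma verts_of_degree_copies_path_3:
  "verts_of_degree (copies s (path_graph 3)) 1 = {..<s} \<times> {0, 2}"
  "verts_of_degree (copies s (path_graph 3)) 2 = {..<s} \<times> {1}"
proof -
  have "verts_of_degree (copies s (path_graph 3)) d =
      {p \<in> {..<s} \<times> {..<3}. (if snd p = 1 then 2 else 1) = d}" for d
    unfolding verts_of_degree_def verts_copies_path_3
    by (rule Collect_cong) (auto simp: degree_copies_path_3)
  then show "verts_of_degree (copies s (path_graph 3)) 1 = {..<s} \<times> {0, 2}"
    "verts_of_degree (copies s (path_graph 3)) 2 = {..<s} \<times> {1}"
    by auto
qed

section \<open>Identifying the concrete graph with blade groups\<close>

text \<open>Groups \<open>2 * i\<close> and \<open>2 * i + 1\<close> are the halves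
  \<open>S_1\<close> and \<open>S_2\<close> of the \<open>i\<close>-th diamond fan; group
  \<open>2 * r\<close> is the fan.\<close>

definition fan_vertex ::
    "nat \<Rightarrow> nat \<Rightarrow> nat \<Rightarrow> nat \<Rightarrow>
      (nat \<times> ((nat \<times> nat) + (nat \<times> nat)) option option) + ((nat \<times> nat) + nat)" where
  "fan_vertex r g t j =
     (if g = 2 * r then Inr (Inl (t, j))
      else Inl (g div 2, Some (Some (if even g then Inl (t, j) else Inr (t, j)))))"

text \<open>The apex of a group is the one joined to its ends: \<open>y = Some None\<close> for
  \<open>S_1\<close> and \<open>z = None\<close> for \<open>S_2\<close>.\<close>

definition apex_vertex ::
    "nat \<Rightarrow> nat \<Rightarrow> (nat \<times> ((nat \<times> nat) + (nat \<times> nat)) option option) + ((nat \<times> nat) + nat)" where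
  "apex_vertex r g =
     (if g = 2 * r then Inr (Inr 0) else Inl (g div 2, if even g then Some None else None))"

definition partner :: "nat \<Rightarrow> nat \<Rightarrow> nat" where
  "partner r g = (if g < 2 * r then if even g then g + 1 else g - 1 else g)"

lemma div_2_parity_eq:
  fixes g h :: nat
  shows "g div 2 = h div 2 \<Longrightarrow> even g = even h \<Longrightarrow> g = h"
  by presburger

lemma partner_less: "g < Suc (2 * r) \<Longrightarrow> partner r g < Suc (2 * r)"
  by (auto simp: partner_def)

lemma partner_partner: "partner r (partner r g) = g"
  by (auto simp: partner_def elim!: oddE)

lemma blade_groups_diamond_fan_r:
  assumes "s \<ge> 2" "even s"
  shows "blade_groups (fan_vertex r) (apex_vertex r) (partner r) (Suc (2 * r)) s"
proof
  show "fan_vertex r g t j = fan_vertex r g' t' j' \<longleftrightarrow> g = g' \<and> t = t' \<and> j = j'" for g t j g' t' j'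
    by (auto simp: fan_vertex_def dest: div_2_parity_eq split: if_splits)
  show "apex_vertex r g = apex_vertex r g' \<longleftrightarrow> g = g'" for g g'
    by (auto simp: apex_vertex_def dest: div_2_parity_eq split: if_splits)
  show "fan_vertex r g t j \<noteq> apex_vertex r g'" for g t j g'
    by (auto simp: fan_vertex_def apex_vertex_def)
  show "bij_betw (partner r) {..<Suc (2 * r)} {..<Suc (2 * r)}"
    by (rule bij_betw_byWitness[where f' = "partner r"])
      (use partner_less partner_partner in auto)
qed (use assms in auto)

lemma image_Times_UN: "f ` (A \<times> B) = (\<Union>a\<in>A. (\<lambda>b. f (a, b)) ` B)"
  by auto

text \<open>All edges are gathered under a single union over \<open>t\<close>, so that they can be
  matched with those of two blade groups blade by blade.\<close>

lemma edges_diamond_fan: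
  "edges (diamond_fan s) = (\<Union>t<s.
     {{Some (Some (Inl (t, 0))), Some (Some (Inl (t, 1)))},
      {Some (Some (Inl (t, 1))), Some (Some (Inl (t, 2)))},
      {Some (Some (Inl (t, 0))), Some None}, {Some (Some (Inl (t, 2))), Some None},
      {Some (Some (Inl (t, 1))), None},
      {Some (Some (Inr (t, 0))), Some (Some (Inr (t, 1)))},
      {Some (Some (Inr (t, 1))), Some (Some (Inr (t, 2)))},
      {Some (Some (Inr (t, 0))), None}, {Some (Some (Inr (t, 2))), None},
      {Some (Some (Inr (t, 1))), Some None}})"
  unfolding diamond_fan_def Let_def verts_of_degree_copies_path_3 add_vertex_def
    disjoint_union_def edges_copies_path_3 graph.sel Setcompr_eq_image image_Times_UN image_Un
    image_UN image_image UN_Un_distrib[symmetric]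
  by (rule SUP_cong[OF refl]) (simp add: insert_commute)

lemma verts_diamond_fan:
  "verts (diamond_fan s) = {None, Some None} \<union>
     (\<lambda>p. Some (Some (Inl p))) ` ({..<s} \<times> {..<3}) \<union> (\<lambda>p. Some (Some (Inr p))) ` ({..<s} \<times> {..<3})"
  by (auto simp: diamond_fan_def Let_def add_vertex_def disjoint_union_def verts_copies_path_3)

lemma edges_fan_blades:
  "edges (fan_blades s) = (\<Union>t<s.
     {{Inl (t, 0), Inl (t, 1)}, {Inl (t, 1), Inl (t, 2)},
      {Inl (t, 0), Inr 0}, {Inl (t, 2), Inr 0}, {Inl (t, 1), Inr 0}})"
proof -
  have three: "{..<3} = {0, 1, 2::nat}" by auto
  have cone: "{{Inl u, Inr v} |u v. u \<in> A \<and> v \<in> {0}} = (\<lambda>u. {Inl u, Inr 0}) ` A"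
    for A :: "(nat \<times> nat) set"
    by auto
  have "edges (complete_graph 1) = {}" "verts (complete_graph 1) = {0}"
    by (auto simp: complete_graph_def)
  then have "edges (fan_blades s) =
      (\<Union>t<s. (`) Inl ` {{(t, 0), (t, 1)}, {(t, 1), (t, 2)}}) \<union>
      (\<Union>t<s. (\<lambda>j. {Inl (t, j), Inr 0}) ` {0, 1, 2})"
    by (simp only: fan_blades_def graph_join_def disjoint_union_def edges_copies_path_3 graph.sel
        verts_copies_path_3 three cone image_Times_UN image_UN image_empty Un_empty_right)
  also have "\<dots> = (\<Union>t<s. (`) Inl ` {{(t, 0), (t, 1)}, {(t, 1), (t, 2)}} \<union>
      (\<lambda>j. {Inl (t, j), Inr 0}) ` {0, 1, 2})"
    by (rule UN_Un_distrib[symmetric])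
  finally show ?thesis by (simp add: insert_commute)
qed

lemma verts_fan_blades: "verts (fan_blades s) = Inl ` ({..<s} \<times> {..<3}) \<union> {Inr 0}"
  by (auto simp: fan_blades_def graph_join_def verts_copies_path_3 complete_graph_def)

lemma UN_lessThan_double_Suc:
  "(\<Union>g<Suc (2 * r). F g) = (\<Union>i<r. F (2 * i) \<union> F (2 * i + 1)) \<union> F (2 * r)" for r :: nat
  by (induction r) (auto simp: lessThan_Suc)

text \<open>The graphs are equal, not merely isomorphic, because \<open>fan_vertex\<close> and
  \<open>apex_vertex\<close> name the actual vertices.\<close>

lemma diamond_fan_r_eq:
  assumes "s \<ge> 2" "even s"
  shows "diamond_fan_r r s =
    blade_groups.G (fan_vertex r) (apex_vertex r) (partner r) (Suc (2 * r)) s"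
proof -
  interpret blade_groups "fan_vertex r" "apex_vertex r" "partner r" "Suc (2 * r)" s
    using assms by (rule blade_groups_diamond_fan_r)
  \<comment> \<open>\<open>E g\<close> and \<open>W g\<close> are the edges and vertices contributed
    by group \<open>g\<close>; two consecutive groups make up a diamond fan.\<close>
  define E where "E g = (\<Union>t<s. (\<lambda>k. edge (g, t, k)) ` {..<5})" for g
  define W where
    "W g = (\<lambda>(t, j). fan_vertex r g t j) ` ({..<s} \<times> {..<3}) \<union> {apex_vertex r g}" for g
  have five: "{..<5} = {0, 1, 2, 3, 4::nat}" by auto
  have "edges (diamond_fan_r r s) =
      (\<Union>i<r. (`) Inl ` (`) (Pair i) ` edges (diamond_fan s)) \<union> (`) Inr ` edges (fan_blades s)"
    by (simp add: diamond_fan_r_def disjoint_union_def copies_def image_UN)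
  also have "\<dots> = (\<Union>i<r. E (2 * i) \<union> E (2 * i + 1)) \<union> E (2 * r)"
  proof (intro arg_cong2[where f = "(\<union>)"] SUP_cong refl)
    fix i assume "i \<in> {..<r}"
    then have i: "i < r" by simp
    \<comment> \<open>These facts decide the case distinctions on \<open>2 * r\<close> in the vertex
      names and in \<open>partner\<close>.\<close>
    then have "2 * i + 1 \<noteq> 2 * r" "2 * i + 1 < 2 * r" by presburger+
    with i show "(`) Inl ` (`) (Pair i) ` edges (diamond_fan s) = E (2 * i) \<union> E (2 * i + 1)"
      by (simp add: edges_diamond_fan E_def five edge_def fan_vertex_def apex_vertex_def
          partner_def image_UN UN_Un_distrib[symmetric] insert_commute)
  next
    show "(`) Inr ` edges (fan_blades s) = E (2 * r)"
      by (simp add: edges_fan_blades E_def five edge_def fan_vertex_def apex_vertex_def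
          partner_def image_UN insert_commute)
  qed
  also have "\<dots> = (\<Union>g<Suc (2 * r). E g)" by (rule UN_lessThan_double_Suc[symmetric])
  also have "\<dots> = edges G" by (force simp: E_def idx_def)
  finally have edges: "edges (diamond_fan_r r s) = edges G" .
  have "verts (diamond_fan_r r s) =
      (\<Union>i<r. Inl ` Pair i ` verts (diamond_fan s)) \<union> Inr ` verts (fan_blades s)"
    by (auto simp: diamond_fan_r_def disjoint_union_def copies_def)
  also have "\<dots> = (\<Union>i<r. W (2 * i) \<union> W (2 * i + 1)) \<union> W (2 * r)"
  proof (intro arg_cong2[where f = "(\<union>)"] SUP_cong refl)
    fix i assume "i \<in> {..<r}"
    then have "2 * i + 1 \<noteq> 2 * r" "i \<noteq> r" by (presburger, simp)
    then show "Inl ` Pair i ` verts (diamond_fan s) = W (2 * i) \<union> W (2 * i + 1)"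
      by (auto simp: verts_diamond_fan W_def fan_vertex_def apex_vertex_def image_iff)
  next
    show "Inr ` verts (fan_blades s) = W (2 * r)"
      by (auto simp: verts_fan_blades W_def fan_vertex_def apex_vertex_def image_iff)
  qed
  also have "\<dots> = (\<Union>g<Suc (2 * r). W g)" by (rule UN_lessThan_double_Suc[symmetric])
  also have "\<dots> = verts G" by (auto simp: W_def verts_G image_Times_UN)
  finally show ?thesis using edges by (simp add: graph.expand)
qed

theorem theorem2p8:
  fixes r s :: nat
  assumes "r \<ge> 1" and "s \<ge> 2" and "even s"
  shows "chi_la (diamond_fan_r r s) = 3"
proof -
  interpret blade_groups "fan_vertex r" "apex_vertex r" "partner r" "Suc (2 * r)" s
    using assms(2,3) by (rule blade_groups_diamond_fan_r)
  note eq = diamond_fan_r_eq[OF assms(2,3), of r]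
  \<comment> \<open>The triangle lies in the first blade of the fan: \<open>partner\<close> fixes
    only group \<open>2 * r\<close> among the groups, so there an end and the middle share their
    apex.\<close>
  let ?v = "fan_vertex r (2 * r) 0" and ?x = "apex_vertex r (2 * r)"
  have e: "edge (2 * r, 0, k) \<in> edges G" if "k < 5" for k
    using assms that by (auto simp: idx_def)
  have v: "?v j \<in> verts G" if "j < 3" for j
    using assms that by (force simp: verts_G)
  have "3 \<le> chi_la G"
  proof (rule chi_la_ge_3_if_triangle[OF _ local_antimagic_labeling])
    show "finite (verts G)" by (simp add: verts_G)
    show "{?v 0, ?v 1, ?x} \<subseteq> verts G" using v by (simp add: verts_G)
    show "{?v 0, ?v 1} \<in> edges G" using e[of 0] by (simp add: edge_def)
    show "{?v 1, ?x} \<in> edges G" using e[of 4] by (simp add: edge_def partner_def)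
    show "{?v 0, ?x} \<in> edges G" using e[of 2] by (simp add: edge_def)
  qed
  moreover have "chi_la G \<le> 3"
    using chi_la_le[OF local_antimagic_labeling] card_induced_le by (rule order_trans)
  ultimately show ?thesis unfolding eq by simp
qed

end
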